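(* For every integer $n>1$, \[ t(n)\ge n-\lceil e\cdot(\ln n+1)\rceil. \]
   Context: A cyclic permutation of order $n$ is a bijective labeling of the vertices of a cycle of length $n$ by the elements of $[n]$, up to rotation of the cycle (reflections are not identified). A swap exchanges the labels of any two (not necessarily adjacent) vertices. $t(n)$ is the maximum, over all cyclic permutations of order $n$, of the minimum number of swaps needed to transform it into the trivial cyclic permutation $(1,2,\ldots,n)$ (labels $1,\ldots,n$ consecutively in order around the cycle). Equivalently, with $c=(1,2,\ldots,n)\in S_n$, $C_n=\langle c\rangle$ and $\operatorname{cyc}(\sigma)$ the number of cycles of $\sigma\in S_n$ (fixed points included), $t(n)=\max_{\pi\in S_n}\min_{\sigma\in\pi C_n}(n-\operatorname{cyc}(\sigma))$. Here $e$ is Euler's number and $\ln$ the natural logarithm. *)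

theory Defs
  imports Complex_Main "HOL-Combinatorics.Multiset_Permutations"
begin

text \<open>
  A bijective labelling of the vertices of an \<open>n\<close>-cycle by \<open>{1..n}\<close> is represented by the list of
  its labels read around the cycle from some base vertex. A cyclic permutation is the set of all
  rotations of such a list.
\<close>

definition rotation_class :: "'a list \<Rightarrow> 'a list set" where
  "rotation_class xs = {rotate k xs | k. True}"

definition cyclic_perms :: "nat \<Rightarrow> nat list set set" where
  "cyclic_perms n = rotation_class ` permutations_of_set {1..n}"

definition trivial_cyclic_perm :: "nat \<Rightarrow> nat list set" where
  "trivial_cyclic_perm n = rotation_class [1..<n + 1]"

definition swap_entries :: "nat \<Rightarrow> nat \<Rightarrow> 'a list \<Rightarrow> 'a list" where
  "swap_entries i j xs = xs[i := xs ! j, j := xs ! i]"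

definition cyclic_swap :: "nat \<Rightarrow> (nat list set \<times> nat list set) set" where
  "cyclic_swap n = {(C, D). C \<in> cyclic_perms n \<and> D \<in> cyclic_perms n \<and>
     (\<exists>xs\<in>C. \<exists>i<n. \<exists>j<n. i \<noteq> j \<and> swap_entries i j xs \<in> D)}"

definition swap_distance :: "nat \<Rightarrow> nat list set \<Rightarrow> nat list set \<Rightarrow> nat" where
  "swap_distance n C D = (LEAST k. (C, D) \<in> cyclic_swap n ^^ k)"

text \<open>The quantity \<open>t(n)\<close>.\<close>

definition max_swaps :: "nat \<Rightarrow> nat" where
  "max_swaps n = Max ((\<lambda>C. swap_distance n C (trivial_cyclic_perm n)) ` cyclic_perms n)"

end

theory Submission imports Defs begin

text \<open>
  Union bound. A permutation of \<open>{..<n}\<close> that is a product of at most \<open>k\<close> transpositions either fixes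
  the last point or is such a product of \<open>k - 1\<close> transpositions of the other points times a
  transposition moving the last point. By induction there are at most
  \<open>x^k * (\<Prod>i=1..<n. 1 + i / x)\<close> of them for every \<open>x \<ge> 1\<close>. A rotation class has at most \<open>n\<close>
  members, so if all classes were within distance \<open>m\<close> of the trivial one, then \<open>n!\<close> would be at
  most \<open>n\<close> times this bound with \<open>k = m\<close>; taking \<open>x = e\<close> makes this fail for
  \<open>m < n - e (ln n + 1)\<close>.
\<close>

subsection \<open>Counting products of transpositions\<close>

text \<open>The ball of radius \<open>k\<close> about \<open>id\<close> in the Cayley graph
  generated by the transpositions of \<open>S\<close>. Pairs with \<open>x = y\<close> contribute
  only the identity.\<close>

primrec swap_ball :: "'a set \<Rightarrow> nat \<Rightarrow> ('a \<Rightarrow> 'a) set" where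
  "swap_ball S 0 = {id}"
| "swap_ball S (Suc k) =
     swap_ball S k \<union> (\<lambda>(f, x, y). f \<circ> transpose x y) ` (swap_ball S k \<times> S \<times> S)"

lemma swap_ball_SucI1: "f \<in> swap_ball S k \<Longrightarrow> f \<in> swap_ball S (Suc k)"
  by simp

lemma swap_ball_SucI2:
  "\<lbrakk>f \<in> swap_ball S k; x \<in> S; y \<in> S\<rbrakk> \<Longrightarrow> f \<circ> transpose x y \<in> swap_ball S (Suc k)"
  by force

lemma swap_ball_mono: "k \<le> l \<Longrightarrow> swap_ball S k \<subseteq> swap_ball S l"
  by (induction rule: dec_induct) auto

lemma finite_swap_ball: "finite S \<Longrightarrow> finite (swap_ball S k)"
  by (induction k) auto

text \<open>All transpositions that move \<open>a\<close> can be pushed to the right end and merged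
  there into at most one, without lengthening the product.\<close>

lemma swap_ball_insert_cases:
  assumes "f \<in> swap_ball (insert a S) k" and "a \<notin> S"
  shows "f \<in> swap_ball S k \<or>
    (\<exists>j b g. k = Suc j \<and> b \<in> S \<and> g \<in> swap_ball S j \<and> f = g \<circ> transpose a b)"
  using assms(1)
proof (induction k arbitrary: f)
  case 0
  then show ?case by (simp add: id_def)
next
  case (Suc k)
  let ?Q = "\<lambda>f k. f \<in> swap_ball S k \<or>
    (\<exists>j b g. k = Suc j \<and> b \<in> S \<and> g \<in> swap_ball S j \<and> f = g \<circ> transpose a b)"
  have up: "?Q f (Suc k)" if "?Q f k" for f
    using that swap_ball_SucI1 by blast
  from Suc.prems consider "f \<in> swap_ball (insert a S) k"
    | f' x y where "f' \<in> swap_ball (insert a S) k" "x \<in> insert a S" "y \<in> insert a S"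
        "f = f' \<circ> transpose x y"
    by auto
  then show ?case
  proof cases
    case 1
    then show ?thesis using Suc.IH up by blast
  next
    case 2
    have Qf': "?Q f' k" using Suc.IH 2(1) .
    have move_a: "?Q (f' \<circ> transpose a y) (Suc k)" if y: "y \<in> S" for y
      using Qf'
    proof
      assume "f' \<in> swap_ball S k"
      then show ?thesis using y by blast
    next
      assume "\<exists>j b g. k = Suc j \<and> b \<in> S \<and> g \<in> swap_ball S j \<and> f' = g \<circ> transpose a b"
      then obtain j b g where h: "k = Suc j" "b \<in> S" "g \<in> swap_ball S j" "f' = g \<circ> transpose a b"
        by blast
      show ?thesis
      proof (cases "y = b")
        case True
        then have "f' \<circ> transpose a y = g" using h by (simp add: comp_assoc)
        then show ?thesis using h swap_ball_SucI1 by metis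
      next
        case False
        \<comment> \<open>Two transpositions through \<open>a\<close> become one inside
          \<open>S\<close> followed on the right by one through \<open>a\<close>; the length stays
          the same.\<close>
        have "transpose a b \<circ> transpose a y = transpose b y \<circ> transpose a b"
          using False y h(2) \<open>a \<notin> S\<close> by (auto simp: fun_eq_iff transpose_def)
        then have "f' \<circ> transpose a y = (g \<circ> transpose b y) \<circ> transpose a b"
          using h(4) by (simp add: comp_assoc)
        then show ?thesis using swap_ball_SucI2[OF h(3,2) y] h(1,2) by blast
      qed
    qed
    consider "x = y" | "x = a" "y \<in> S" | "y = a" "x \<in> S" | "x \<noteq> y" "x \<in> S" "y \<in> S"
      using 2 by blast
    then show ?thesis
    proof cases
      case 1
      then have "f = f'" using 2 by simp
      then show ?thesis using up Qf' by blast
    next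
      case 2
      then show ?thesis using move_a \<open>f = f' \<circ> transpose x y\<close> by blast
    next
      case 3
      then show ?thesis using move_a \<open>f = f' \<circ> transpose x y\<close> by (metis transpose_commute)
    next
      case 4
      from Qf' show ?thesis
      proof
        assume "f' \<in> swap_ball S k"
        then show ?thesis unfolding 2(4) using 4 by (intro disjI1 swap_ball_SucI2)
      next
        assume "\<exists>j b g. k = Suc j \<and> b \<in> S \<and> g \<in> swap_ball S j \<and> f' = g \<circ> transpose a b"
        then obtain j b g where h: "k = Suc j" "b \<in> S" "g \<in> swap_ball S j" "f' = g \<circ> transpose a b"
          by blast
        \<comment> \<open>A transposition of \<open>S\<close> passes to the left of
          \<open>(a b)\<close> by conjugation, which replaces \<open>b\<close> by its image.\<close>
        have "transpose a b \<circ> transpose x y = transpose x y \<circ> transpose a (transpose x y b)"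
          using 4 h(2) \<open>a \<notin> S\<close> by (auto simp: fun_eq_iff transpose_def)
        then have "f = (g \<circ> transpose x y) \<circ> transpose a (transpose x y b)"
          using h(4) 2(4) by (simp add: comp_assoc)
        moreover have "transpose x y b \<in> S" using 4 h(2) by (auto simp: transpose_def)
        ultimately show ?thesis using swap_ball_SucI2[OF h(3) 4(2,3)] h(1) by blast
      qed
    qed
  qed
qed

text \<open>The second case of \<open>swap_ball_insert_cases\<close> is determined by the pair of
  \<open>b\<close> and \<open>g\<close>. This is the recurrence of the unsigned Stirling numbers of
  the first kind, summed over the number of transpositions.\<close>

lemma card_swap_ball_insert:
  assumes "finite S" "a \<notin> S"
  shows "card (swap_ball (insert a S) (Suc k))
    \<le> card (swap_ball S (Suc k)) + card S * card (swap_ball S k)"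
proof -
  let ?T = "(\<lambda>(b, g). g \<circ> transpose a b) ` (S \<times> swap_ball S k)"
  have fin: "finite (swap_ball S k)" "finite (swap_ball S (Suc k))"
    using assms finite_swap_ball by blast+
  have "swap_ball (insert a S) (Suc k) \<subseteq> swap_ball S (Suc k) \<union> ?T"
    using swap_ball_insert_cases[OF _ assms(2), of _ "Suc k"] by fast
  then have "card (swap_ball (insert a S) (Suc k)) \<le> card (swap_ball S (Suc k) \<union> ?T)"
    using assms(1) fin by (intro card_mono finite_UnI finite_imageI finite_cartesian_product) auto
  also have "\<dots> \<le> card (swap_ball S (Suc k)) + card ?T"
    by (rule card_Un_le)
  also have "card ?T \<le> card S * card (swap_ball S k)"
    using card_image_le[of "S \<times> swap_ball S k"] assms(1) fin by (simp add: card_cartesian_product)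
  finally show ?thesis by simp
qed

text \<open>A generating function bound: if c_j permutations need exactly j transpositions, then for
  x >= 1 the sum of c_j over j <= k is at most x^k times the sum of all c_j x^(-j), which factors as
  the product. The induction gets it directly from the recurrence.\<close>

lemma card_swap_ball_le:
  fixes x :: real
  assumes x: "x \<ge> 1"
  shows "real (card (swap_ball {..<n} k)) \<le> x ^ k * (\<Prod>i<n. 1 + real i / x)"
proof (induction n arbitrary: k)
  case 0
  have "swap_ball {..<0::nat} k = {id}" by (induction k) auto
  then show ?case using x by (simp add: one_le_power)
next
  case (Suc n)
  show ?case
  proof (cases k)
    case 0
    have "(\<Prod>i<Suc n. 1 + real i / x) \<ge> 1" using x by (intro prod_ge_1) simp
    then show ?thesis using 0 by simp
  next
    case k: (Suc j)
    have "real (card (swap_ball {..<Suc n} (Suc j)))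
        \<le> real (card (swap_ball {..<n} (Suc j)) + n * card (swap_ball {..<n} j))"
      unfolding of_nat_le_iff lessThan_Suc
      using card_swap_ball_insert[of "{..<n}" n j] by (simp del: swap_ball.simps)
    also have "\<dots> \<le> x ^ Suc j * (\<Prod>i<n. 1 + real i / x)
        + real n * (x ^ j * (\<Prod>i<n. 1 + real i / x))"
      unfolding of_nat_add of_nat_mult
      by (intro add_mono mult_left_mono Suc.IH) simp
    also have "\<dots> = x ^ Suc j * (\<Prod>i<Suc n. 1 + real i / x)"
      using x by (simp add: field_simps)
    finally show ?thesis using k by simp
  qed
qed

text \<open>Each new factor, divided by n + 1, is 1 + (e - 1)/(n + 1) <= exp((e - 1)/(n + 1)), and
  1/(n + 1) <= ln(n + 1) - ln n, so the exponents telescope. The \<open>+ 1\<close> beside the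
  logarithm pays for the factor at i = 0.\<close>

lemma prod_exp_1_plus_le:
  assumes "n \<ge> 1"
  shows "(\<Prod>i<n. exp 1 + real i) \<le> fact n * exp ((exp 1 - 1) * (ln (real n) + 1))"
  using assms
proof (induction n rule: dec_induct)
  case base
  \<comment> \<open>At n = 1 the claim is e <= exp(e - 1), hence e >= 2 is enough.\<close>
  have "exp 1 \<ge> (2::real)" using exp_ge_add_one_self[of "1::real"] by simp
  then show ?case by simp
next
  case (step n)
  have n: "real n > 0" using step by simp
  have "ln (real n / real (Suc n)) \<le> real n / real (Suc n) - 1"
    using n by (intro ln_le_minus_one) simp
  then have l: "1 / real (Suc n) \<le> ln (real (Suc n)) - ln (real n)"
    using n by (simp add: ln_div field_simps)
  have "(exp 1 + real n) / real (Suc n) = 1 + (exp 1 - 1) * (1 / real (Suc n))"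
    by (simp add: field_simps)
  also have "\<dots> \<le> exp ((exp 1 - 1) * (1 / real (Suc n)))"
    by (rule exp_ge_add_one_self)
  also have "\<dots> \<le> exp ((exp 1 - 1) * (ln (real (Suc n)) - ln (real n)))"
    using mult_left_mono[OF l, of "exp 1 - 1"] by simp
  finally have s: "exp 1 + real n \<le> real (Suc n) * exp ((exp 1 - 1) * (ln (real (Suc n)) - ln (real n)))"
    by (simp add: field_simps)
  have "(\<Prod>i<Suc n. exp 1 + real i) = (\<Prod>i<n. exp 1 + real i) * (exp 1 + real n)"
    by simp
  also have "\<dots> \<le> (fact n * exp ((exp 1 - 1) * (ln (real n) + 1))) *
      (real (Suc n) * exp ((exp 1 - 1) * (ln (real (Suc n)) - ln (real n))))"
    by (intro mult_mono step.IH s mult_nonneg_nonneg add_nonneg_nonneg) auto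
  also have "\<dots> = fact (Suc n) * exp ((exp 1 - 1) * (ln (real n) + 1)
      + (exp 1 - 1) * (ln (real (Suc n)) - ln (real n)))"
    by (simp add: exp_add)
  also have "(exp 1 - 1) * (ln (real n) + 1) + (exp 1 - 1) * (ln (real (Suc n)) - ln (real n))
      = (exp 1 - 1) * (ln (real (Suc n)) + 1)"
    by (simp add: algebra_simps)
  finally show ?case .
qed

subsection \<open>Rotation classes and swaps\<close>

lemma rotation_class_self: "xs \<in> rotation_class xs"
  unfolding rotation_class_def using rotate0 by (auto intro: exI[of _ 0])

lemma rotation_class_eqI:
  assumes "ys \<in> rotation_class xs"
  shows "rotation_class ys = rotation_class xs"
proof -
  obtain k where ys: "ys = rotate k xs" using assms by (auto simp: rotation_class_def)
  \<comment> \<open>Rotating by \<open>l\<close> completes a full turn; reducing \<open>k\<close>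
    first keeps the subtraction from truncating.\<close>
  define l where "l = length xs - k mod length xs"
  have "rotate l ys = xs"
  proof (cases "xs = []")
    case False
    have "rotate l ys = rotate (l + k mod length xs) xs"
      by (metis ys rotate_rotate rotate_conv_mod)
    also have "l + k mod length xs = length xs" using False by (simp add: l_def mod_le_divisor)
    finally show ?thesis by simp
  qed (simp add: ys)
  then have "\<exists>j. rotate i xs = rotate j ys" for i
    by (metis rotate_rotate)
  moreover have "\<exists>j. rotate i ys = rotate j xs" for i
    by (metis ys rotate_rotate)
  ultimately show ?thesis unfolding rotation_class_def by (auto; blast)
qed

lemma rotation_class_conv_less:
  assumes "xs \<noteq> []"
  shows "rotation_class xs = (\<lambda>k. rotate k xs) ` {..<length xs}"
  unfolding rotation_class_def using assms
  by (auto simp: image_iff) (metis length_greater_0_conv lessThan_iff mod_less_divisor rotate_conv_mod)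

lemma length_swap_entries [simp]: "length (swap_entries i j xs) = length xs"
  by (simp add: swap_entries_def)

lemma nth_swap_entries:
  "\<lbrakk>i < length xs; j < length xs; m < length xs\<rbrakk> \<Longrightarrow> swap_entries i j xs ! m = xs ! transpose i j m"
  by (auto simp: swap_entries_def nth_list_update transpose_def)

lemma swap_entries_swap_entries:
  "\<lbrakk>i < length xs; j < length xs\<rbrakk> \<Longrightarrow> swap_entries i j (swap_entries i j xs) = xs"
  by (rule nth_equalityI) (auto simp: nth_swap_entries transpose_def)

text \<open>Rotation permutes the positions, so it conjugates a swap into the swap of the preimages
  of \<open>i\<close> and \<open>j\<close>.\<close>

lemma rotate_swap_entries:
  assumes "i < length xs" "j < length xs"
  shows "\<exists>i' < length xs. \<exists>j' < length xs.
    rotate r (swap_entries i j xs) = swap_entries i' j' (rotate r xs)"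
proof -
  let ?n = "length xs"
  define \<rho> where "\<rho> m = (r + m) mod ?n" for m
  have "inj_on \<rho> {..<?n}"
  proof (rule linorder_inj_onI)
    fix a b assume ab: "a < b" "a \<in> {..<?n}" "b \<in> {..<?n}"
    show "\<rho> a \<noteq> \<rho> b"
    proof
      assume "\<rho> a = \<rho> b"
      then have "?n dvd (r + b) - (r + a)"
        using ab mod_eq_dvd_iff_nat[of "r + a" "r + b" ?n] by (simp add: \<rho>_def)
      then show False using ab by (auto dest: dvd_imp_le)
    qed
  qed auto
  moreover have "\<rho> ` {..<?n} \<subseteq> {..<?n}" using assms by (auto simp: \<rho>_def intro!: mod_less_divisor)
  \<comment> \<open>An injective self-map of a finite set is onto, which provides the
    preimages.\<close>
  ultimately have b: "\<rho> ` {..<?n} = {..<?n}"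
    by (intro endo_inj_surj) auto
  have "i \<in> \<rho> ` {..<?n}" "j \<in> \<rho> ` {..<?n}" unfolding b using assms by simp_all
  then obtain i' j' where ij: "i' < ?n" "\<rho> i' = i" "j' < ?n" "\<rho> j' = j"
    by blast
  have "rotate r (swap_entries i j xs) = swap_entries i' j' (rotate r xs)"
  proof (rule nth_equalityI)
    fix m assume "m < length (rotate r (swap_entries i j xs))"
    then have m: "m < ?n" by simp
    have "\<rho> m < ?n" using assms by (auto simp: \<rho>_def intro!: mod_less_divisor)
    have "\<rho> (transpose i' j' m) = transpose i j (\<rho> m)"
      using ij m \<open>inj_on \<rho> {..<?n}\<close> by (auto simp: transpose_def inj_on_eq_iff)
    moreover have "transpose i' j' m < ?n" using ij m by (auto simp: transpose_def)
    ultimately show "rotate r (swap_entries i j xs) ! m = swap_entries i' j' (rotate r xs) ! m"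
      using m ij assms \<open>\<rho> m < ?n\<close>
      by (simp add: nth_rotate nth_swap_entries \<rho>_def[symmetric])
  qed simp
  then show ?thesis using ij by blast
qed

section \<open>Labellings as permutations and paths of swaps\<close>

lemma mset_swap_entries:
  "\<lbrakk>i < length xs; j < length xs\<rbrakk> \<Longrightarrow> mset (swap_entries i j xs) = mset xs"
  unfolding swap_entries_def by (rule mset_swap)

lemma permutations_of_set_swap_entries:
  assumes "xs \<in> permutations_of_set A" "i < length xs" "j < length xs"
  shows "swap_entries i j xs \<in> permutations_of_set A"
  using assms mset_swap_entries[OF assms(2,3)]
  by (auto simp: permutations_of_set_def dest: mset_eq_setD mset_eq_imp_distinct_iff)

lemma length_permutations_upto: "xs \<in> permutations_of_set {1..n} \<Longrightarrow> length xs = n"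
  by (simp add: length_finite_permutations_of_set)

lemma length_mem_cyclic_perms: "\<lbrakk>C \<in> cyclic_perms n; xs \<in> C\<rbrakk> \<Longrightarrow> length xs = n"
  by (auto simp: cyclic_perms_def rotation_class_def length_permutations_upto)

lemma cyclic_perms_eq_rotation_class: "\<lbrakk>C \<in> cyclic_perms n; xs \<in> C\<rbrakk> \<Longrightarrow> C = rotation_class xs"
  by (auto simp: cyclic_perms_def dest: rotation_class_eqI)

text \<open>\<open>Suc\<close> reconciles positions counted from 0 with labels counted from 1, so
  that \<open>id\<close> gives the trivial labelling.\<close>

definition list_of_perm :: "nat \<Rightarrow> (nat \<Rightarrow> nat) \<Rightarrow> nat list" where
  "list_of_perm n f = map (\<lambda>i. Suc (f i)) [0..<n]"

text \<open>Swapping positions is multiplication on the right, the side on which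
  \<open>swap_ball\<close> grows.\<close>

lemma swap_entries_list_of_perm:
  "\<lbrakk>i < n; j < n\<rbrakk> \<Longrightarrow> swap_entries i j (list_of_perm n f) = list_of_perm n (f \<circ> transpose i j)"
  by (rule nth_equalityI) (auto simp: nth_swap_entries list_of_perm_def transpose_def)

text \<open>The path is followed backwards from the trivial class. A swap may act on any
  representative, but by \<open>rotate_swap_entries\<close> it can be carried to the one already
  known, so each step costs just one transposition.\<close>

lemma swap_path_imp_swap_ball:
  assumes "(C, trivial_cyclic_perm n) \<in> cyclic_swap n ^^ k"
  shows "\<exists>f \<in> swap_ball {..<n} k. list_of_perm n f \<in> C"
  using assms
proof (induction k arbitrary: C)
  case 0
  have "list_of_perm n id = [1..<n + 1]"
    by (rule nth_equalityI) (auto simp: list_of_perm_def simp del: upt_Suc)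
  then have "list_of_perm n id \<in> trivial_cyclic_perm n"
    unfolding trivial_cyclic_perm_def by (simp only: rotation_class_self)
  then show ?case using 0 by (simp add: id_def)
next
  case (Suc k)
  then obtain D where CD: "(C, D) \<in> cyclic_swap n" and "(D, trivial_cyclic_perm n) \<in> cyclic_swap n ^^ k"
    by (meson relpow_Suc_E2)
  then obtain f where f: "f \<in> swap_ball {..<n} k" "list_of_perm n f \<in> D"
    using Suc.IH by blast
  obtain xs i j where x: "C \<in> cyclic_perms n" "D \<in> cyclic_perms n" "xs \<in> C" "i < n" "j < n"
      "swap_entries i j xs \<in> D"
    using CD by (auto simp: cyclic_swap_def)
  have len: "length xs = n" using x length_mem_cyclic_perms by blast
  have "list_of_perm n f \<in> rotation_class (swap_entries i j xs)"
    using f x cyclic_perms_eq_rotation_class by blast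
  then obtain r where "list_of_perm n f = rotate r (swap_entries i j xs)"
    by (auto simp: rotation_class_def)
  then obtain i' j' where ij: "i' < n" "j' < n"
      and "list_of_perm n f = swap_entries i' j' (rotate r xs)"
    using rotate_swap_entries[of i xs j r] x len by auto
  \<comment> \<open>Swaps are involutions: undoing this one turns the known representative of
    \<open>D\<close> into one of \<open>C\<close>.\<close>
  then have "rotate r xs = swap_entries i' j' (list_of_perm n f)"
    using len by (simp add: swap_entries_swap_entries)
  also have "\<dots> = list_of_perm n (f \<circ> transpose i' j')"
    using ij by (rule swap_entries_list_of_perm)
  finally have "list_of_perm n (f \<circ> transpose i' j') \<in> C"
    using cyclic_perms_eq_rotation_class[OF x(1,3)] by (auto simp: rotation_class_def dest: sym)
  moreover have "f \<circ> transpose i' j' \<in> swap_ball {..<n} (Suc k)"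
    using f ij by (intro swap_ball_SucI2) auto
  ultimately show ?case by blast
qed

text \<open>Selection sort, with \<open>d\<close> bounding the number of positions still to be
  settled. It ensures that the \<open>LEAST\<close> in \<open>swap_distance\<close> ranges over a
  nonempty set.\<close>

lemma trivial_cyclic_perm_reachable:
  assumes "xs \<in> permutations_of_set {1..n}" "\<And>i. i < n - d \<Longrightarrow> xs ! i = Suc i"
  shows "(rotation_class xs, trivial_cyclic_perm n) \<in> (cyclic_swap n)\<^sup>*"
  using assms
proof (induction d arbitrary: xs)
  case 0
  then have "xs = [1..<n + 1]"
    by (intro nth_equalityI) (auto simp: length_permutations_upto simp del: upt_Suc)
  then show ?case by (simp add: trivial_cyclic_perm_def)
next
  case (Suc d)
  note len = length_permutations_upto[OF Suc.prems(1)]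
  define p where "p = n - Suc d"
  show ?case
  \<comment> \<open>If \<open>Suc d > n\<close>, the truncated differences \<open>n - d\<close> and
    \<open>n - Suc d\<close> are both 0 and there is nothing to sort.\<close>
  proof (cases "Suc d \<le> n \<and> xs ! p \<noteq> Suc p")
    case False
    have "xs ! i = Suc i" if "i < n - d" for i
    proof (cases "i < n - Suc d")
      case False
      then have "i = p" "Suc d \<le> n" using that by (auto simp: p_def)
      then show ?thesis using \<open>\<not> (Suc d \<le> n \<and> _)\<close> by simp
    qed (rule Suc.prems(2))
    then show ?thesis using Suc by blast
  next
    case True
    then have p: "p < n" by (simp add: p_def)
    have "Suc p \<in> set xs" using Suc.prems(1) p by (simp add: permutations_of_set_def)
    then obtain q where q: "q < n" "xs ! q = Suc p" using len by (metis in_set_conv_nth)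
    \<comment> \<open>Earlier positions hold smaller labels, so the swap leaves the sorted prefix
      intact.\<close>
    have "q > p"
    proof (rule ccontr)
      assume "\<not> p < q"
      then have "q < p" using True q by (metis linorder_neqE_nat)
      then show False using Suc.prems(2)[of q] q by (simp add: p_def)
    qed
    let ?ys = "swap_entries p q xs"
    have ys: "?ys \<in> permutations_of_set {1..n}"
      using Suc.prems(1) len p q permutations_of_set_swap_entries by blast
    have "?ys ! i = Suc i" if "i < n - d" for i
    proof (cases "i = p")
      case True
      then show ?thesis using q p len by (simp add: nth_swap_entries)
    next
      case False
      then have "i < p" using that True by (auto simp: p_def)
      then show ?thesis using Suc.prems(2)[of i] \<open>q > p\<close> q p len
        by (simp add: nth_swap_entries transpose_def p_def)
    qed
    then have "(rotation_class ?ys, trivial_cyclic_perm n) \<in> (cyclic_swap n)\<^sup>*"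
      using Suc.IH ys by blast
    moreover have "(rotation_class xs, rotation_class ?ys) \<in> cyclic_swap n"
      unfolding cyclic_swap_def cyclic_perms_def
      using Suc.prems(1) ys p q \<open>q > p\<close> rotation_class_self by blast
    ultimately show ?thesis by (rule converse_rtrancl_into_rtrancl[rotated])
  qed
qed

lemma swap_distance_relpow:
  assumes "C \<in> cyclic_perms n"
  shows "(C, trivial_cyclic_perm n) \<in> cyclic_swap n ^^ swap_distance n C (trivial_cyclic_perm n)"
proof -
  obtain xs where "xs \<in> permutations_of_set {1..n}" "C = rotation_class xs"
    using assms by (auto simp: cyclic_perms_def)
  then have "(C, trivial_cyclic_perm n) \<in> (cyclic_swap n)\<^sup>*"
    using trivial_cyclic_perm_reachable[of xs n n] by simp
  then obtain k where "(C, trivial_cyclic_perm n) \<in> cyclic_swap n ^^ k"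
    using rtrancl_imp_relpow by blast
  then show ?thesis unfolding swap_distance_def by (rule LeastI)
qed

section \<open>Counting classes and the final estimate\<close>

lemma finite_cyclic_perms: "finite (cyclic_perms n)"
  by (simp add: cyclic_perms_def)

text \<open>The classes cover all n! labellings, and each has at most n rotations.\<close>

lemma fact_le_card_cyclic_perms:
  assumes "n \<ge> 1"
  shows "fact n \<le> n * card (cyclic_perms n)"
proof -
  have cls: "finite C \<and> card C \<le> n" if C: "C \<in> cyclic_perms n" for C
  proof -
    obtain xs where xs: "xs \<in> permutations_of_set {1..n}" "C = rotation_class xs"
      using C by (auto simp: cyclic_perms_def)
    have "length xs = n" using xs length_permutations_upto by blast
    moreover from this have "xs \<noteq> []" using assms by auto
    ultimately have "C = (\<lambda>k. rotate k xs) ` {..<n}"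
      using xs(2) rotation_class_conv_less[of xs] by metis
    then show ?thesis using card_image_le[of "{..<n}" "\<lambda>k. rotate k xs"] by simp
  qed
  have "permutations_of_set {1..n} \<subseteq> \<Union>(cyclic_perms n)"
    using rotation_class_self by (auto simp: cyclic_perms_def)
  then have "card (permutations_of_set {1..n}) \<le> card (\<Union>(cyclic_perms n))"
    using cls finite_cyclic_perms by (intro card_mono finite_Union) auto
  also have "\<dots> \<le> (\<Sum>C\<in>cyclic_perms n. card C)"
    using card_Union_le_sum_card by blast
  also have "\<dots> \<le> (\<Sum>C\<in>cyclic_perms n. n)"
    using cls by (intro sum_mono) auto
  finally show ?thesis by (simp add: mult.commute)
qed

text \<open>Every class contains a labelling that comes from the ball of radius
  \<open>max_swaps n\<close>, so the ball maps onto a set containing all classes.\<close>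

lemma card_cyclic_perms_le_swap_ball:
  "card (cyclic_perms n) \<le> card (swap_ball {..<n} (max_swaps n))"
proof -
  have "\<exists>f \<in> swap_ball {..<n} (max_swaps n). C = rotation_class (list_of_perm n f)"
    if C: "C \<in> cyclic_perms n" for C
  proof -
    let ?d = "swap_distance n C (trivial_cyclic_perm n)"
    obtain f where f: "f \<in> swap_ball {..<n} ?d" "list_of_perm n f \<in> C"
      using swap_path_imp_swap_ball[OF swap_distance_relpow[OF C]] by blast
    have "?d \<le> max_swaps n"
      unfolding max_swaps_def using C finite_cyclic_perms by (intro Max_ge) auto
    then show ?thesis
      using f swap_ball_mono cyclic_perms_eq_rotation_class[OF C] by blast
  qed
  then have "cyclic_perms n \<subseteq> (\<lambda>f. rotation_class (list_of_perm n f)) ` swap_ball {..<n} (max_swaps n)"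
    by blast
  then show ?thesis
    by (meson card_image_le card_mono finite_imageI finite_lessThan finite_swap_ball order_trans)
qed

theorem theorem3p10:
  fixes n :: nat
  assumes "n > 1"
  shows "int (max_swaps n) \<ge> int n - \<lceil>exp 1 * (ln (real n) + 1)\<rceil>"
proof -
  define m where "m = max_swaps n"
  \<comment> \<open>For general x > 1 the argument bounds n - m by about x ln n / ln x, which is
    least at x = e.\<close>
  define x where "x = (exp 1 :: real)"
  have x: "x \<ge> 1" "x > 0" by (simp_all add: x_def)
  have pe: "x ^ k = exp (real k)" for k
    by (simp add: x_def exp_of_nat_mult[symmetric])
  have "(\<Prod>i<n. 1 + real i / x) * x ^ n = (\<Prod>i<n. (1 + real i / x) * x)"
    by (simp add: prod.distrib)
  also have "\<dots> = (\<Prod>i<n. exp 1 + real i)"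
    using x by (intro prod.cong) (auto simp: field_simps x_def)
  finally have P: "(\<Prod>i<n. 1 + real i / x) = (\<Prod>i<n. exp 1 + real i) / x ^ n"
    using x by (simp add: field_simps)
  have "fact n \<le> real n * real (card (cyclic_perms n))"
    using fact_le_card_cyclic_perms[of n] assms
    by (metis less_imp_le of_nat_fact of_nat_le_iff of_nat_mult)
  also have "\<dots> \<le> real n * real (card (swap_ball {..<n} m))"
    unfolding m_def using card_cyclic_perms_le_swap_ball by (intro mult_left_mono) auto
  also have "\<dots> \<le> real n * (x ^ m * (\<Prod>i<n. 1 + real i / x))"
    using card_swap_ball_le[OF x(1)] by (intro mult_left_mono) auto
  also have "\<dots> = real n * exp (real m - real n) * (\<Prod>i<n. exp 1 + real i)"
    by (simp add: P pe exp_diff)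
  also have "\<dots> \<le> real n * exp (real m - real n) *
      (fact n * exp ((exp 1 - 1) * (ln (real n) + 1)))"
    using assms by (intro mult_left_mono prod_exp_1_plus_le) auto
  \<comment> \<open>The number n of rotations enters the exponent as ln n, and ln n + (e - 1)(ln n +
    1) = e (ln n + 1) - 1.\<close>
  also have "\<dots> = fact n * (exp (ln (real n)) * exp (real m - real n) *
      exp ((exp 1 - 1) * (ln (real n) + 1)))"
    using assms by simp
  also have "\<dots> = fact n * exp (real m - real n + exp 1 * (ln (real n) + 1) - 1)"
    unfolding exp_add[symmetric] by (simp add: algebra_simps)
  finally have "1 \<le> exp (real m - real n + exp 1 * (ln (real n) + 1) - 1)"
    by simp
  then have "real n - real m \<le> exp 1 * (ln (real n) + 1)"
    by simp
  then have "int n - int m \<le> \<lceil>exp 1 * (ln (real n) + 1)\<rceil>"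
    by linarith
  then show ?thesis by (simp add: m_def)
qed

end
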